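(* Let $\mathbf{M}$ be a mean. If $x,y\in\mathbb{R}^n$ have positive entries and $x\prec^{w}y$, then there exists a positive definite $A\in M_{2n}$ such that $x=\mathrm{diag}_{\mathbf{M}}(A)$ and the entries of $y$ (counted with multiplicity) are the symplectic eigenvalues of $A$, i.e. $\delta(A)=[y_j^\uparrow]_{j=1}^n$.
   Context: $M_{m,n}$ is the set of $m\times n$ real matrices, $M_n=M_{n,n}$, $I_n$ is the identity matrix and $0_n$ the zero matrix of size $n$; $n\ge 1$ is an integer. Positive definite matrices are real symmetric positive definite. A (generalized) mean $\mathbf{M}$ is a positive continuous function on $(0,\infty)\times(0,\infty)$ such that for all $a,b>0$: (i) $\mathbf{M}(a,b)=\mathbf{M}(b,a)$; (ii) $\mathbf{M}(ra,rb)=r\mathbf{M}(a,b)$ for all $r>0$; (iii) $\mathbf{M}(a,b)$ is monotone increasing in $a$ and $b$; (iv) if $a\le b$, then $a\le \mathbf{M}(a,b)\le b$. For $A=[a_{ij}]_{i,j=1}^{2n}\in M_{2n}$ with all $a_{ii}>0$, the symplectic diagonal of $A$ associated with $\mathbf{M}$ is the vector $\mathrm{diag}_{\mathbf{M}}(A)=[\mathbf{M}(a_{ii},a_{n+i,n+i})]_{i=1}^n\in\mathbb{R}^n$. Let $J_{2n}=\begin{bmatrix}0_n & I_n\\ -I_n & 0_n\end{bmatrix}$. A matrix $W\in M_{2n}$ is symplectic if $W^\top J_{2n}W=J_{2n}$. By Williamson's theorem, every positive definite $A\in M_{2n}$ can be written as $A=W(D\oplus D)W^\top$ with $W$ symplectic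 and $D=\mathrm{diag}(\delta_1,\dots,\delta_n)$ a diagonal matrix with positive diagonal entries, unique up to permutation of its diagonal entries. The numbers $\delta_1,\dots,\delta_n$ (with multiplicity) are the symplectic eigenvalues of $A$, and $\delta(A)=[\delta_j^\uparrow]_{j=1}^n$ is the vector of symplectic eigenvalues in nondecreasing order. For real $z_1,\dots,z_n$, $z_1^\uparrow\le\cdots\le z_n^\uparrow$ denotes their nondecreasing rearrangement. For $x,y\in\mathbb{R}^n$, $x\prec^w y$ ($x$ is weakly supermajorized by $y$) means $\sum_{j=1}^k x_j^\uparrow\ge\sum_{j=1}^k y_j^\uparrow$ for all $k=1,\dots,n$. *)

theory Defs
  imports Complex_Main "Jordan_Normal_Form.Matrix"
begin

text \<open>
  Vectors in $R^n$ and matrices are the carrier-based \<^typ>\<open>real vec\<close> and \<^typ>\<open>real mat\<close>;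
  indices run from \<open>0\<close> to \<open>n - 1\<close>.
\<close>

text \<open>Only the values of a mean on $(0,\infty) \times (0,\infty)$ are constrained.\<close>

definition is_mean :: "(real \<Rightarrow> real \<Rightarrow> real) \<Rightarrow> bool" where
  "is_mean M \<longleftrightarrow>
     (\<forall>a>0. \<forall>b>0. M a b > 0) \<and>
     continuous_on ({0<..} \<times> {0<..}) (\<lambda>(a, b). M a b) \<and>
     (\<forall>a>0. \<forall>b>0. M a b = M b a) \<and>
     (\<forall>a>0. \<forall>b>0. \<forall>r>0. M (r * a) (r * b) = r * M a b) \<and>
     (\<forall>a>0. \<forall>a'>0. \<forall>b>0. \<forall>b'>0. a \<le> a' \<longrightarrow> b \<le> b' \<longrightarrow> M a b \<le> M a' b') \<and>
     (\<forall>a>0. \<forall>b>0. a \<le> b \<longrightarrow> a \<le> M a b \<and> M a b \<le> b)"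

definition positive_definite :: "nat \<Rightarrow> real mat \<Rightarrow> bool" where
  "positive_definite m A \<longleftrightarrow>
     A \<in> carrier_mat m m \<and> transpose_mat A = A \<and>
     (\<forall>v \<in> carrier_vec m. v \<noteq> 0\<^sub>v m \<longrightarrow> v \<bullet> (A *\<^sub>v v) > 0)"

definition symplectic_diag :: "(real \<Rightarrow> real \<Rightarrow> real) \<Rightarrow> nat \<Rightarrow> real mat \<Rightarrow> real vec" where
  "symplectic_diag M n A = vec n (\<lambda>i. M (A $$ (i, i)) (A $$ (n + i, n + i)))"

definition J_mat :: "nat \<Rightarrow> real mat" where
  "J_mat n = four_block_mat (0\<^sub>m n n) (1\<^sub>m n) (- 1\<^sub>m n) (0\<^sub>m n n)"

definition symplectic_mat :: "nat \<Rightarrow> real mat \<Rightarrow> bool" where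
  "symplectic_mat n W \<longleftrightarrow>
     W \<in> carrier_mat (2 * n) (2 * n) \<and> transpose_mat W * J_mat n * W = J_mat n"

definition direct_sum_mat :: "real mat \<Rightarrow> real mat \<Rightarrow> real mat" where
  "direct_sum_mat B C =
     four_block_mat B (0\<^sub>m (dim_row B) (dim_col C)) (0\<^sub>m (dim_row C) (dim_col B)) C"

text \<open>
  \<open>d\<close> is the diagonal of \<open>D\<close> in a Williamson decomposition
  $A = W (D \oplus D) W^\top$ of \<open>A\<close>, in some order.
\<close>

definition williamson_diag :: "nat \<Rightarrow> real mat \<Rightarrow> real vec \<Rightarrow> bool" where
  "williamson_diag n A d \<longleftrightarrow>
     d \<in> carrier_vec n \<and> (\<forall>i<n. d $ i > 0) \<and>
     (\<exists>W. symplectic_mat n W \<and>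
        A = W * direct_sum_mat (mat_diag n (\<lambda>i. d $ i)) (mat_diag n (\<lambda>i. d $ i)) * transpose_mat W)"

definition increasing_rearrangement :: "real vec \<Rightarrow> real vec" where
  "increasing_rearrangement z = vec_of_list (sort (list_of_vec z))"

text \<open>
  By Williamson's theorem the diagonal entries of \<open>D\<close> exist and are unique up to order when
  \<open>A\<close> is positive definite of size \<open>2 * n\<close>, so for such \<open>A\<close> the description below picks out
  exactly one vector.
\<close>

definition symplectic_eigenvalues :: "nat \<Rightarrow> real mat \<Rightarrow> real vec" where
  "symplectic_eigenvalues n A =
     (THE d. williamson_diag n A d \<and> increasing_rearrangement d = d)"

definition weakly_supermajorized :: "nat \<Rightarrow> real vec \<Rightarrow> real vec \<Rightarrow> bool" where
  "weakly_supermajorized n x y \<longleftrightarrow>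
     (\<forall>k \<in> {1..n}. (\<Sum>j<k. increasing_rearrangement x $ j) \<ge> (\<Sum>j<k. increasing_rearrangement y $ j))"

end

theory Submission
  imports Defs "Jordan_Normal_Form.Char_Poly"
begin

text \<open>
  Transfers \<open>(a, b) \<mapsto> (t, a + b - t)\<close> with \<open>a \<le> t \<le> b\<close>, together with permutations, turn \<open>y\<close> into
  some \<open>z \<le> x\<close> when \<open>x\<close> is weakly supermajorized by \<open>y\<close>. Rotating two rows of an orthogonal
  matrix \<open>U\<close> realises a transfer on the diagonal of \<open>U D U\<^sup>T\<close>, so that \<open>z\<close> becomes such a
  diagonal with \<open>D = diag(y)\<close>. The orthogonal symplectic \<open>U \<oplus> U\<close> gives \<open>U D U\<^sup>T \<oplus> U D U\<^sup>T\<close>, where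
  each mode \<open>(i, n + i)\<close> carries the block \<open>z\<^sub>i I\<close>; conjugating it by the hyperbolic rotation
  with rows \<open>(c\<^sub>i, s\<^sub>i)\<close> and \<open>(s\<^sub>i, c\<^sub>i)\<close> multiplies both of its diagonal entries by
  \<open>c\<^sub>i\<^sup>2 + s\<^sub>i\<^sup>2 = x\<^sub>i / z\<^sub>i\<close>. Both entries of the mode are then \<open>x\<^sub>i\<close>, hence so is their mean.
\<close>

section \<open>Weak supermajorization and transfers between two entries\<close>

lemma sum_list_take_le_const:
  fixes p xs :: "real list"
  assumes "\<forall>u\<in>set p. u \<le> x" "\<forall>u\<in>set xs. x \<le> u" "k \<le> length p" "k \<le> length xs"
  shows "sum_list (take k p) \<le> sum_list (take k xs)"
proof -
  have "p ! i \<le> xs ! i" if "i < k" for i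
    using assms that by (meson nth_mem order_trans less_le_trans)
  then show ?thesis
    using assms by (auto simp: sum_list_sum_nth intro!: sum_mono)
qed

text \<open>Induction on \<open>xs\<close>, smallest target first, with \<open>ps\<close> collecting
  the targets already attained exactly. If every remaining entry is at most \<open>x\<close>, the
  list is already below the rest of the sorted targets. Otherwise neighbours \<open>a\<close> and
  \<open>b\<close> of \<open>ys\<close> straddle \<open>x\<close>; a transfer turns one into
  \<open>x\<close> and the other into \<open>m = a + b - x\<close>. Since \<open>m\<close> lies
  between \<open>a\<close> and \<open>b\<close>, the list left over stays sorted.\<close>

lemma transfers_reach_below:
  fixes Q :: "real list \<Rightarrow> bool"
  assumes perm: "\<And>us vs. mset us = mset vs \<Longrightarrow> Q us \<Longrightarrow> Q vs"
    and transfer: "\<And>a b t us. Q (a # b # us) \<Longrightarrow> a \<le> t \<Longrightarrow> t \<le> b \<Longrightarrow> Q (t # (a + b - t) # us)"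
    and "length xs = length ys" "sorted xs" "sorted ys"
    and "\<And>k. k \<le> length xs \<Longrightarrow> sum_list (take k ys) \<le> sum_list (take k xs)"
    and "Q (ps @ ys)"
  shows "\<exists>zs. Q (ps @ zs) \<and> list_all2 (\<le>) zs xs"
  using assms(3-)
proof (induction xs arbitrary: ps ys)
  case Nil
  then show ?case by auto
next
  case (Cons x xs)
  show ?case
  proof (cases "\<forall>u\<in>set ys. u \<le> x")
    case True
    have "list_all2 (\<le>) ys (x # xs)"
      unfolding list_all2_conv_all_nth
    proof (intro conjI allI impI)
      fix i assume "i < length ys"
      moreover have "x \<le> (x # xs) ! i"
        using Cons.prems(1,2) \<open>i < length ys\<close> by (cases i) auto
      ultimately show "ys ! i \<le> (x # xs) ! i"
        using True by (meson nth_mem order_trans)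
    qed (use Cons.prems in auto)
    then show ?thesis using Cons.prems by blast
  next
    case False
    define us where "us = takeWhile (\<lambda>u. u \<le> x) ys"
    define vs where "vs = dropWhile (\<lambda>u. u \<le> x) ys"
    have ys: "ys = us @ vs" by (simp add: us_def vs_def)
    have "vs \<noteq> []" using False by (auto simp: vs_def)
    then obtain b q where vs: "vs = b # q" by (cases vs) auto
    have xb: "x < b"
      using hd_dropWhile[of "\<lambda>u. u \<le> x" ys] vs \<open>vs \<noteq> []\<close> unfolding vs_def[symmetric] by auto
    \<comment> \<open>The prefix inequality for \<open>k = 1\<close> supplies an entry at most
      \<open>x\<close>, so a straddling pair exists.\<close>
    have "hd ys \<le> x" "ys \<noteq> []"
      using Cons.prems(1) Cons.prems(4)[of 1] by (cases ys; simp)+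
    then have "us \<noteq> []" unfolding us_def by (cases ys) auto
    then obtain p a where us: "us = p @ [a]" by (cases us rule: rev_cases) auto
    have le: "\<forall>u\<in>set us. u \<le> x" unfolding us_def by (auto dest: set_takeWhileD)
    define m where "m = a + b - x"
    have ax: "a \<le> x" using le us by auto
    have ys': "ys = p @ a # b # q" using ys us vs by simp
    have m: "a \<le> m" "m \<le> b" using ax xb by (auto simp: m_def)
    have so: "sorted (p @ m # q)"
      using Cons.prems(3) m unfolding ys' by (fastforce simp: sorted_append)
    have "Q (a # b # ps @ p @ q)"
      using perm[OF _ Cons.prems(5), of "a # b # ps @ p @ q"] by (simp add: ys')
    from transfer[OF this ax] xb have "Q (x # m # ps @ p @ q)" by (simp add: m_def)
    from perm[OF _ this, of "(ps @ [x]) @ (p @ m # q)"]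
    have Q': "Q ((ps @ [x]) @ (p @ m # q))" by simp
    \<comment> \<open>A prefix inside \<open>p\<close> has only entries at most \<open>x\<close>,
      while \<open>xs\<close> has only entries at least \<open>x\<close>. A prefix reaching
      \<open>m\<close> contains \<open>a + b - x\<close>, so its sum is that of the first
      \<open>Suc k\<close> entries of \<open>ys\<close> minus \<open>x\<close>, and \<open>x\<close>
      cancels against the head of \<open>x # xs\<close>.\<close>
    have sums: "sum_list (take k (p @ m # q)) \<le> sum_list (take k xs)" if k: "k \<le> length xs" for k
    proof (cases "k \<le> length p")
      case True
      have "sum_list (take k p) \<le> sum_list (take k xs)"
        by (rule sum_list_take_le_const[of _ x]) (use le us Cons.prems(2) True k in auto)
      then show ?thesis using True by simp
    next
      case False
      then obtain l where l: "k = length p + Suc l"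
        by (metis add_Suc_right less_imp_Suc_add not_le)
      have "sum_list (take (Suc k) ys) \<le> sum_list (take (Suc k) (x # xs))"
        using Cons.prems(4)[of "Suc k"] k by simp
      then show ?thesis by (simp add: ys' l m_def)
    qed
    have "\<exists>zs. Q ((ps @ [x]) @ zs) \<and> list_all2 (\<le>) zs xs"
      by (rule Cons.IH[of "p @ m # q"]) (use Cons.prems ys' so sums Q' in auto)
    then obtain zs where "Q ((ps @ [x]) @ zs)" "list_all2 (\<le>) zs xs" by blast
    then show ?thesis by (intro exI[of _ "x # zs"]) auto
  qed
qed

section \<open>Diagonals of orthogonal conjugates\<close>

definition orthonormal_rows :: "nat \<Rightarrow> (nat \<Rightarrow> nat \<Rightarrow> real) \<Rightarrow> bool" where
  "orthonormal_rows n U \<longleftrightarrow>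
     (\<forall>i<n. \<forall>k<n. (\<Sum>j<n. U i j * U k j) = (if i = k then 1 else 0))"

text \<open>The sums are the diagonal entries of U diag(d) U^T. Keeping \<open>U\<close> as a
  function makes permuting and rotating its rows pointwise operations.\<close>

definition conjugate_diagonal :: "nat \<Rightarrow> (nat \<Rightarrow> real) \<Rightarrow> real list \<Rightarrow> bool" where
  "conjugate_diagonal n d zs \<longleftrightarrow> length zs = n \<and>
     (\<exists>U. orthonormal_rows n U \<and> (\<forall>i<n. (\<Sum>j<n. (U i j)\<^sup>2 * d j) = zs ! i))"

lemma conjugate_diagonal_refl: "conjugate_diagonal n d (map d [0..<n])"
proof -
  have "orthonormal_rows n (\<lambda>i j. if i = j then 1 else 0)"
    unfolding orthonormal_rows_def by (auto simp: if_distrib[of "\<lambda>z. z * _"] cong: if_cong)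
  moreover have "(\<Sum>j<n. (if i = j then 1 else 0)\<^sup>2 * d j) = d i" if "i < n" for i
    using that by (simp add: if_distrib[of "\<lambda>z. z ^ 2"] if_distrib[of "\<lambda>z. z * _"] cong: if_cong)
  ultimately show ?thesis
    unfolding conjugate_diagonal_def by auto
qed

lemma conjugate_diagonal_perm:
  assumes "mset us = mset vs" "conjugate_diagonal n d us"
  shows "conjugate_diagonal n d vs"
proof -
  from assms(2) obtain U where len: "length us = n" and U: "orthonormal_rows n U"
    and us: "\<And>i. i < n \<Longrightarrow> (\<Sum>j<n. (U i j)\<^sup>2 * d j) = us ! i"
    unfolding conjugate_diagonal_def by blast
  obtain p where p: "p permutes {..<length us}" and vs: "permute_list p us = vs"
    using mset_eq_permutation[OF assms(1)[symmetric]] by blast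
  have pn: "p i < n \<longleftrightarrow> i < n" for i
    using permutes_in_image[OF p, of i] len by simp
  have pinj: "p i = p k \<longleftrightarrow> i = k" for i k
    using permutes_inj[OF p] by (auto dest: injD)
  have "orthonormal_rows n (\<lambda>i. U (p i))"
    using U unfolding orthonormal_rows_def by (simp add: pn pinj)
  moreover have "(\<Sum>j<n. (U (p i) j)\<^sup>2 * d j) = vs ! i" if "i < n" for i
    using that us[of "p i"] permute_list_nth[OF p, of i] len pn by (simp add: vs)
  ultimately show ?thesis
    using vs len unfolding conjugate_diagonal_def by (intro conjI exI) auto
qed

text \<open>As the first two rows of \<open>U\<close> are rotated, the first diagonal entry moves
  continuously from \<open>a\<close> at angle 0 to \<open>b\<close> at pi/2, so it equals
  \<open>t\<close> at some angle. The rotation preserves the sum of the two entries, which fixes the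
  second one.\<close>

lemma conjugate_diagonal_transfer:
  assumes "conjugate_diagonal n d (a # b # us)" "a \<le> t" "t \<le> b"
  shows "conjugate_diagonal n d (t # (a + b - t) # us)"
proof -
  from assms(1) obtain U where len: "length (a # b # us) = n" and U: "orthonormal_rows n U"
    and us: "\<And>i. i < n \<Longrightarrow> (\<Sum>j<n. (U i j)\<^sup>2 * d j) = (a # b # us) ! i"
    unfolding conjugate_diagonal_def by blast
  have n: "0 < n" "Suc 0 < n" using len by auto
  define g where "g = (\<lambda>\<theta>. \<Sum>j<n. (cos \<theta> * U 0 j + sin \<theta> * U (Suc 0) j)\<^sup>2 * d j)"
  have g0: "g 0 = a" and g1: "g (pi / 2) = b"
    using us[OF n(1)] us[OF n(2)] by (simp_all add: g_def)
  have "\<exists>\<theta>\<ge>0. \<theta> \<le> pi / 2 \<and> g \<theta> = t"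
    by (rule IVT') (use assms g0 g1 in \<open>auto simp: g_def intro!: continuous_intros\<close>)
  then obtain \<theta> where \<theta>: "g \<theta> = t" by blast
  define c s where "c = cos \<theta>" and "s = sin \<theta>"
  have cs: "c * c + s * s = 1"
    unfolding c_def s_def using sin_cos_squared_add3[of \<theta>] by simp
  define V where "V = (\<lambda>i j. if i = 0 then c * U 0 j + s * U 1 j
      else if i = 1 then - s * U 0 j + c * U 1 j else U i j)"
  have ip: "(\<Sum>j<n. U i j * U k j) = (if i = k then 1 else 0)" if "i < n" "k < n" for i k
    using U that unfolding orthonormal_rows_def by blast
  have lin: "(\<Sum>j<n. (\<alpha> * U i j + \<beta> * U k j) * (\<gamma> * U i' j + \<epsilon> * U k' j)) =
     \<alpha> * \<gamma> * (\<Sum>j<n. U i j * U i' j) + \<alpha> * \<epsilon> * (\<Sum>j<n. U i j * U k' j)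
     + \<beta> * \<gamma> * (\<Sum>j<n. U k j * U i' j) + \<beta> * \<epsilon> * (\<Sum>j<n. U k j * U k' j)"
    for \<alpha> \<beta> \<gamma> \<epsilon> i k i' k'
    by (simp add: sum_distrib_left sum.distrib[symmetric] algebra_simps)
  \<comment> \<open>Each row, rotated or not, is a combination of two rows of \<open>U\<close>, so
    \<open>lin\<close> reduces all inner products to \<open>ip\<close> without a case split on the
    sums.\<close>
  have V: "V i j = (if i = 0 then c else if i = 1 then - s else 1) * U (if i \<le> 1 then 0 else i) j
      + (if i = 0 then s else if i = 1 then c else 0) * U 1 j" for i j
    by (auto simp: V_def)
  have "orthonormal_rows n V"
    unfolding orthonormal_rows_def V lin
    using n cs by (auto simp: ip algebra_simps)
  moreover have "(\<Sum>j<n. (V i j)\<^sup>2 * d j) = (t # (a + b - t) # us) ! i" if i: "i < n" for i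
  proof -
    consider "i = 0" | "i = 1" | "i > 1" by linarith
    then show ?thesis
    proof cases
      case 1
      then show ?thesis using \<theta> by (simp add: V_def g_def c_def s_def)
    next
      case 2
      have "(- s * u + c * v)\<^sup>2 * e = u\<^sup>2 * e + v\<^sup>2 * e - (c * u + s * v)\<^sup>2 * e" for u v e
      proof -
        have "(- s * u + c * v)\<^sup>2 + (c * u + s * v)\<^sup>2 = (c * c + s * s) * (u\<^sup>2 + v\<^sup>2)"
          by (simp add: power2_eq_square algebra_simps)
        then have "(- s * u + c * v)\<^sup>2 = u\<^sup>2 + v\<^sup>2 - (c * u + s * v)\<^sup>2"
          by (simp add: cs)
        then show ?thesis by (metis distrib_right left_diff_distrib)
      qed
      then have "(\<Sum>j<n. (V i j)\<^sup>2 * d j) =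
          (\<Sum>j<n. (U 0 j)\<^sup>2 * d j) + (\<Sum>j<n. (U (Suc 0) j)\<^sup>2 * d j) - g \<theta>"
        using 2 by (simp add: V_def g_def c_def s_def sum.distrib sum_subtractf)
      then show ?thesis using us[OF n(1)] us[OF n(2)] \<theta> 2 by simp
    next
      case 3
      then show ?thesis using us[OF i] by (simp add: V_def nth_Cons split: nat.split)
    qed
  qed
  ultimately show ?thesis
    using len unfolding conjugate_diagonal_def by (intro conjI exI) auto
qed

lemma conjugate_diagonal_below:
  fixes xs ys :: "real list"
  assumes len: "length xs = n" "length ys = n" and "sorted ys"
    and "\<And>k. k \<le> n \<Longrightarrow> sum_list (take k ys) \<le> sum_list (take k (sort xs))"
  shows "\<exists>zs. conjugate_diagonal n (\<lambda>j. ys ! j) zs \<and> list_all2 (\<le>) zs xs"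
proof -
  let ?Q = "conjugate_diagonal n (\<lambda>j. ys ! j)"
  have "map (\<lambda>j. ys ! j) [0..<n] = ys" unfolding len(2)[symmetric] by (rule map_nth)
  then have "?Q ([] @ ys)" using conjugate_diagonal_refl[of n "\<lambda>j. ys ! j"] by simp
  then have "\<exists>zs. ?Q ([] @ zs) \<and> list_all2 (\<le>) zs (sort xs)"
  proof (rule transfers_reach_below[where Q = ?Q, rotated 6])
    show "?Q vs" if "mset us = mset vs" "?Q us" for us vs
      using conjugate_diagonal_perm that .
    show "?Q (t # (a + b - t) # us)" if "?Q (a # b # us)" "a \<le> t" "t \<le> b" for a b t us
      using conjugate_diagonal_transfer that .
  qed (use assms in auto)
  then obtain zs where zs: "?Q zs" "list_all2 (\<le>) zs (sort xs)" by auto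
  \<comment> \<open>The reordering rule permutes the left list. Turning the relation around lets
    \<open>sort xs\<close> be brought back to \<open>xs\<close>, with \<open>zs\<close> permuted
    along.\<close>
  have "list_all2 (\<ge>) (sort xs) zs"
    using zs(2) by (simp add: list_all2_conv_all_nth)
  then obtain zs' where "list_all2 (\<ge>) xs zs'" "mset zs' = mset zs"
    using list_all2_reorder_left_invariance[of "(\<ge>)" "sort xs" zs xs] by auto
  then show ?thesis
    using conjugate_diagonal_perm[OF _ zs(1), of zs']
    by (intro exI[of _ zs']) (auto simp: list_all2_conv_all_nth)
qed

section \<open>Symplectic matrices and Williamson decompositions\<close>

lemma J_mat_carrier [simp]: "J_mat n \<in> carrier_mat (2 * n) (2 * n)"
  unfolding J_mat_def mult_2 by simp

lemma J_mat_square: "J_mat n * J_mat n = - 1\<^sub>m (2 * n)"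
  unfolding J_mat_def
  by (subst mult_four_block_mat[of _ n n _ n _ n _ _ n _ n])
     (auto simp: mult_2 intro!: eq_matI)

text \<open>Because J^2 = -I, multiplying W^T J W = J by -J from the left exhibits \<open>V\<close>
  as the inverse of \<open>W\<close>. The last identity turns congruence by \<open>W\<close> into
  similarity once the matrix is multiplied by J.\<close>

lemma symplectic_mat_inverse:
  assumes "symplectic_mat n W"
  defines "V \<equiv> - (J_mat n * transpose_mat W * J_mat n)"
  shows "V \<in> carrier_mat (2 * n) (2 * n)" "V * W = 1\<^sub>m (2 * n)" "W * V = 1\<^sub>m (2 * n)"
    "transpose_mat W * J_mat n = J_mat n * V"
proof -
  let ?N = "2 * n" and ?J = "J_mat n"
  have W: "W \<in> carrier_mat ?N ?N" and WJ: "transpose_mat W * ?J * W = ?J"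
    using assms unfolding symplectic_mat_def by auto
  note [simp] = W J_mat_carrier[of n]
  have WT[simp]: "transpose_mat W \<in> carrier_mat ?N ?N" using W by simp
  show V: "V \<in> carrier_mat ?N ?N" unfolding V_def
    by (intro uminus_carrier_mat mult_carrier_mat[of _ _ ?N]) auto
  have JJ: "?J * (?J * X) = - X" if "X \<in> carrier_mat ?N ?N" for X
    using that by (simp add: assoc_mult_mat[of _ ?N ?N _ ?N _ ?N, symmetric] J_mat_square)
  have "V * W = - (?J * (transpose_mat W * ?J * W))"
  proof -
    have "V * W = - (?J * transpose_mat W * ?J * W)"
      unfolding V_def
      by (intro uminus_mult_left_mat) (simp add: carrier_matD[OF J_mat_carrier] carrier_matD[OF W])
    then show ?thesis
      using W by (simp add: assoc_mult_mat[OF J_mat_carrier WT J_mat_carrier]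
          assoc_mult_mat[OF J_mat_carrier mult_carrier_mat[OF WT J_mat_carrier] W])
  qed
  also have "\<dots> = 1\<^sub>m ?N" unfolding WJ J_mat_square by simp
  finally show VW: "V * W = 1\<^sub>m ?N" .
  show "W * V = 1\<^sub>m ?N" by (rule mat_mult_left_right_inverse[OF V W VW])
  show "transpose_mat W * ?J = ?J * V"
  proof -
    let ?X = "transpose_mat W * ?J"
    have X: "?X \<in> carrier_mat ?N ?N" by (rule mult_carrier_mat[OF WT J_mat_carrier])
    have "?J * V = ?J * - (?J * ?X)"
      unfolding V_def assoc_mult_mat[OF J_mat_carrier WT J_mat_carrier] ..
    also have "\<dots> = - (?J * (?J * ?X))"
      by (intro uminus_mult_right_mat) (simp add: carrier_matD[OF J_mat_carrier])
    finally show ?thesis unfolding JJ[OF X] by simp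
  qed
qed

lemma direct_sum_mat_diag:
  "direct_sum_mat (mat_diag n f) (mat_diag n g) = mat_diag (n + n) (\<lambda>i. if i < n then f i else g (i - n))"
  unfolding direct_sum_mat_def by (rule eq_matI) (auto simp: mat_diag_def)

text \<open>With u = W^T v the quadratic form becomes that of the positive diagonal matrix at
  \<open>u\<close>, and \<open>u\<close> is nonzero because \<open>W\<close> is invertible.\<close>

lemma williamson_diag_positive_definite:
  assumes "williamson_diag n A d"
  shows "positive_definite (2 * n) A"
proof -
  let ?N = "2 * n"
  obtain W where W: "symplectic_mat n W" and pos: "\<forall>i<n. d $ i > 0"
    and A: "A = W * direct_sum_mat (mat_diag n (\<lambda>i. d $ i)) (mat_diag n (\<lambda>i. d $ i)) * transpose_mat W"
    using assms unfolding williamson_diag_def by blast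
  define e where "e = (\<lambda>i. if i < n then d $ i else d $ (i - n))"
  have A: "A = W * mat_diag ?N e * transpose_mat W"
    using A unfolding direct_sum_mat_diag e_def mult_2 .
  have Wc: "W \<in> carrier_mat ?N ?N" using W unfolding symplectic_mat_def by simp
  have WT: "transpose_mat W \<in> carrier_mat ?N ?N" using Wc by simp
  have E: "mat_diag ?N e \<in> carrier_mat ?N ?N" by simp
  have ET: "transpose_mat (mat_diag ?N e) = mat_diag ?N e"
    by (rule eq_matI) (auto simp: mat_diag_def)
  have WE: "W * mat_diag ?N e \<in> carrier_mat ?N ?N" using Wc by simp
  have sym: "transpose_mat A = A"
    unfolding A transpose_mult[OF WE WT] transpose_mult[OF Wc E] ET transpose_transpose
    using Wc by (simp add: assoc_mult_mat[of _ ?N ?N _ ?N _ ?N])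
  obtain V where V: "V \<in> carrier_mat ?N ?N" "W * V = 1\<^sub>m ?N"
    using symplectic_mat_inverse[OF W] by blast
  have "v \<bullet> (A *\<^sub>v v) > 0" if v: "v \<in> carrier_vec ?N" "v \<noteq> 0\<^sub>v ?N" for v
  proof -
    define u where "u = transpose_mat W *\<^sub>v v"
    have u: "u \<in> carrier_vec ?N" unfolding u_def using WT v by simp
    have "transpose_mat V * transpose_mat W = 1\<^sub>m ?N"
      using transpose_mult[OF Wc V(1)] V(2) by simp
    then have "transpose_mat V *\<^sub>v u = v"
      unfolding u_def using V(1) WT v
      by (subst assoc_mult_mat_vec[symmetric, of _ ?N ?N _ ?N]) auto
    then have "u \<noteq> 0\<^sub>v ?N" using v V(1) by auto
    then obtain k where k: "k < ?N" "u $ k \<noteq> 0" using u by (metis eq_vecI carrier_vecD index_zero_vec)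
    have e: "e i > 0" if "i < ?N" for i using that pos by (auto simp: e_def)
    have Eu: "mat_diag ?N e *\<^sub>v u = vec ?N (\<lambda>i. e i * u $ i)"
      by (rule eq_vecI) (use u in \<open>auto simp: mat_diag_def scalar_prod_def if_distrib[of "\<lambda>z. z * _"] cong: if_cong\<close>)
    have "A *\<^sub>v v = W *\<^sub>v (mat_diag ?N e *\<^sub>v u)"
      unfolding A u_def using Wc WT E v WE
      by (simp add: assoc_mult_mat_vec[of _ ?N ?N _ ?N])
    moreover have "mat_diag ?N e *\<^sub>v u \<in> carrier_vec ?N" by (simp add: Eu)
    from transpose_vec_mult_scalar[OF Wc this v(1)]
    have "u \<bullet> (mat_diag ?N e *\<^sub>v u) = v \<bullet> (W *\<^sub>v (mat_diag ?N e *\<^sub>v u))"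
      unfolding u_def .
    ultimately have "v \<bullet> (A *\<^sub>v v) = u \<bullet> (mat_diag ?N e *\<^sub>v u)" by simp
    also have "\<dots> = (\<Sum>i<?N. e i * (u $ i)\<^sup>2)"
      unfolding Eu scalar_prod_def by (auto simp: power2_eq_square algebra_simps atLeast0LessThan)
    also have "\<dots> > 0"
      by (rule sum_pos2[of _ k]) (use k e in \<open>auto simp: less_imp_le\<close>)
    finally show ?thesis .
  qed
  moreover have "A \<in> carrier_mat ?N ?N" unfolding A by (rule mult_carrier_mat[OF WE WT])
  ultimately show ?thesis unfolding positive_definite_def using sym by blast
qed

section \<open>Uniqueness of the symplectic eigenvalues\<close>

lemma proots_prod_linear: "proots (\<Prod>a\<leftarrow>as. [:- a, 1:]) = mset (as :: real list)"
proof -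
  have nz: "(\<Prod>a\<leftarrow>bs. [:- a, 1:]) \<noteq> 0" for bs :: "real list"
    unfolding prod_list_zero_iff by auto
  show ?thesis
  proof (induction as)
    case (Cons a as)
    have "proots ([:- a, 1:] * (\<Prod>a\<leftarrow>as. [:- a, 1:])) = proots [:- a, 1:] + mset as"
      unfolding Cons.IH[symmetric] by (rule proots_mult[OF _ nz]) simp
    then show ?case by (simp del: mult_pCons_left)
  qed simp
qed

text \<open>The matrix \<open>A J\<close> is similar to \<open>(D \<oplus> D) J\<close>, whose square is \<open>-(D\<^sup>2 \<oplus> D\<^sup>2)\<close>.\<close>

lemma williamson_diag_char_poly:
  assumes "williamson_diag n A d"
  shows "char_poly ((A * J_mat n) * (A * J_mat n)) =
    (\<Prod>a\<leftarrow>map (\<lambda>t. - t\<^sup>2) (list_of_vec d @ list_of_vec d). [:- a, 1:])"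
proof -
  let ?N = "2 * n" and ?J = "J_mat n"
  obtain W where W: "symplectic_mat n W" and d: "d \<in> carrier_vec n"
    and A: "A = W * direct_sum_mat (mat_diag n (\<lambda>i. d $ i)) (mat_diag n (\<lambda>i. d $ i)) * transpose_mat W"
    using assms unfolding williamson_diag_def by blast
  define D where "D = mat_diag n (\<lambda>i. d $ i)"
  define E where "E = direct_sum_mat D D"
  have Dc: "D \<in> carrier_mat n n" by (simp add: D_def)
  have E: "E \<in> carrier_mat ?N ?N" using Dc unfolding E_def direct_sum_mat_def mult_2 by simp
  have A: "A = W * E * transpose_mat W" using A unfolding E_def D_def .
  have Wc: "W \<in> carrier_mat ?N ?N" using W unfolding symplectic_mat_def by simp
  have WT: "transpose_mat W \<in> carrier_mat ?N ?N" using Wc by simp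
  note J = J_mat_carrier[of n]
  obtain V where V: "V \<in> carrier_mat ?N ?N" "V * W = 1\<^sub>m ?N" "W * V = 1\<^sub>m ?N"
    "transpose_mat W * ?J = ?J * V"
    using symplectic_mat_inverse[OF W] by blast
  have EJ: "E * ?J \<in> carrier_mat ?N ?N" using E J by simp
  note assoc = assoc_mult_mat[of _ ?N ?N _ ?N _ ?N]
  have AJ: "A * ?J = W * (E * ?J) * V"
  proof -
    have "A * ?J = W * (E * (transpose_mat W * ?J))"
      unfolding A using Wc E WT J by (simp add: assoc)
    also have "\<dots> = W * (E * ?J) * V"
      unfolding V(4) using Wc E V(1) J by (simp add: assoc)
    finally show ?thesis .
  qed
  have "(A * ?J) * (A * ?J) = W * (E * ?J) * (V * W) * ((E * ?J) * V)"
    unfolding AJ using Wc EJ V(1) by (simp add: assoc)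
  also have "\<dots> = W * ((E * ?J) * (E * ?J)) * V"
    unfolding V(2) right_mult_one_mat[OF mult_carrier_mat[OF Wc EJ]]
    using Wc EJ V(1) by (simp add: assoc)
  finally have sq: "(A * ?J) * (A * ?J) = W * ((E * ?J) * (E * ?J)) * V" .
  have AJc: "A * ?J \<in> carrier_mat ?N ?N" unfolding AJ using Wc EJ V(1) by simp
  have "similar_mat ((A * ?J) * (A * ?J)) ((E * ?J) * (E * ?J))"
    by (rule similar_matI[OF _ V(3,2) sq]) (use AJc EJ Wc V(1) in auto)
  then have "char_poly ((A * ?J) * (A * ?J)) = char_poly ((E * ?J) * (E * ?J))"
    by (rule char_poly_similar)
  \<comment> \<open>The eigenvalues of \<open>E * ?J\<close> are purely imaginary. Its square is a
    real diagonal matrix, so the characteristic polynomial splits over the reals and can be read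
    off.\<close>
  moreover have sqE: "(E * ?J) * (E * ?J) =
      mat_diag ?N (\<lambda>i. if i < n then - (d $ i)\<^sup>2 else - (d $ (i - n))\<^sup>2)"
  proof -
    have EJ': "E * ?J = four_block_mat (0\<^sub>m n n) D (- D) (0\<^sub>m n n)"
      unfolding E_def direct_sum_mat_def J_mat_def using Dc
      by (subst mult_four_block_mat[of _ n n _ n _ n _ _ n _ n]) auto
    have DD: "D * D = mat_diag n (\<lambda>i. (d $ i)\<^sup>2)"
      unfolding D_def by (simp add: power2_eq_square)
    have "(E * ?J) * (E * ?J) = four_block_mat (- (D * D)) (0\<^sub>m n n) (0\<^sub>m n n) (- (D * D))"
      unfolding EJ' using Dc
      by (subst mult_four_block_mat[of _ n n _ n _ n _ _ n _ n]) auto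
    then show ?thesis
      unfolding DD by (intro eq_matI) (auto simp: mat_diag_def)
  qed
  moreover have "diag_mat ((E * ?J) * (E * ?J)) = map (\<lambda>t. - t\<^sup>2) (list_of_vec d @ list_of_vec d)"
    unfolding sqE using d
    by (intro nth_equalityI) (auto simp: diag_mat_def mat_diag_def nth_append list_of_vec_index)
  moreover have "upper_triangular ((E * ?J) * (E * ?J))"
    unfolding sqE by (auto simp: mat_diag_def)
  ultimately show ?thesis
    using char_poly_upper_triangular[of "(E * ?J) * (E * ?J)" ?N] EJ by simp
qed

text \<open>The characteristic polynomial depends on \<open>A\<close> alone, and its roots are the
  numbers -t^2, each entry t of the diagonal contributing twice. Halving the multiplicities and
  applying sqrt(-r) recovers the entries, since they are positive.\<close>

lemma williamson_diag_unique:
  assumes "williamson_diag n A d" "williamson_diag n A d'"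
  shows "mset (list_of_vec d) = mset (list_of_vec d')"
proof -
  define f :: "real \<Rightarrow> real" where "f = (\<lambda>t. - t\<^sup>2)"
  have recover: "image_mset (\<lambda>r. sqrt (- r)) (mset (map f (list_of_vec z))) = mset (list_of_vec z)"
    if "williamson_diag n A z" for z
  proof -
    have "sqrt (- f t) = t" if "t \<in> set (list_of_vec z)" for t
      using that \<open>williamson_diag n A z\<close>
      by (auto simp: f_def williamson_diag_def in_set_conv_nth list_of_vec_index less_imp_le)
    then show ?thesis by (simp add: mset_map[symmetric] map_idI del: mset_map)
  qed
  let ?m = "\<lambda>z. mset (map f (list_of_vec z))"
  have "?m d + ?m d = ?m d' + ?m d'"
    using arg_cong[OF trans[OF williamson_diag_char_poly[OF assms(1), symmetric]
        williamson_diag_char_poly[OF assms(2)]], of proots]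
    unfolding proots_prod_linear f_def[symmetric] by simp
  then have "?m d = ?m d'"
    by (auto simp: multiset_eq_iff simp flip: mult_2)
  then show ?thesis using recover assms by metis
qed

lemma symplectic_eigenvalues_eqI:
  assumes "williamson_diag n A d" "increasing_rearrangement d = d"
  shows "symplectic_eigenvalues n A = d"
  unfolding symplectic_eigenvalues_def
proof (rule the_equality)
  fix d' assume "williamson_diag n A d' \<and> increasing_rearrangement d' = d'"
  moreover from this have "mset (list_of_vec d') = mset (list_of_vec d)"
    using williamson_diag_unique assms by blast
  ultimately show "d' = d"
    using assms(2) unfolding increasing_rearrangement_def
    by (metis properties_for_sort sorted_sort mset_sort)
qed (use assms in auto)

section \<open>Squeezing an orthogonal conjugation\<close>

text \<open>A right inverse of a square matrix is also a left inverse. The symplectic condition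
  below involves inner products of columns, whereas the diagonal was controlled through
  rows.\<close>

lemma orthonormal_rows_columns:
  assumes "orthonormal_rows n U" "j < n" "k < n"
  shows "(\<Sum>i<n. U i j * U i k) = (if j = k then 1 else 0)"
proof -
  define B where "B = mat n n (\<lambda>(i, j). U i j)"
  have B: "B \<in> carrier_mat n n" by (simp add: B_def)
  have "B * transpose_mat B = 1\<^sub>m n"
    using assms(1) unfolding orthonormal_rows_def
    by (intro eq_matI) (auto simp: B_def scalar_prod_def atLeast0LessThan)
  then have "transpose_mat B * B = 1\<^sub>m n"
    using mat_mult_left_right_inverse[OF B] B by simp
  then have "(transpose_mat B * B) $$ (j, k) = (if j = k then 1 else 0)"
    using assms by simp
  then show ?thesis using assms by (simp add: B_def scalar_prod_def atLeast0LessThan)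
qed

text \<open>\<open>W\<close> is the hyperbolic rotation of all modes after U \<oplus> U, so P =
  diag(c) U and R = diag(s) U. Being symplectic amounts to P^T R = R^T P and P^T P - R^T R = I; the
  latter is U^T diag(c^2 - s^2) U = U^T U = I. Both diagonal blocks of \<open>A\<close> are P D P^T
  + R D R^T.\<close>

lemma squeezed_orthogonal_williamson:
  fixes c s :: "nat \<Rightarrow> real"
  assumes U: "orthonormal_rows n U" and cs: "\<And>i. i < n \<Longrightarrow> (c i)\<^sup>2 - (s i)\<^sup>2 = 1"
    and d: "d \<in> carrier_vec n" "\<forall>i<n. d $ i > 0"
  shows "\<exists>A. williamson_diag n A d \<and>
    (\<forall>i<n. A $$ (i, i) = ((c i)\<^sup>2 + (s i)\<^sup>2) * (\<Sum>j<n. (U i j)\<^sup>2 * d $ j) \<and>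
      A $$ (n + i, n + i) = ((c i)\<^sup>2 + (s i)\<^sup>2) * (\<Sum>j<n. (U i j)\<^sup>2 * d $ j))"
proof -
  define P where "P = mat n n (\<lambda>(i, j). c i * U i j)"
  define R where "R = mat n n (\<lambda>(i, j). s i * U i j)"
  define W where "W = four_block_mat P R R P"
  define D where "D = mat_diag n (\<lambda>i. d $ i)"
  define A where "A = W * direct_sum_mat D D * transpose_mat W"
  have c: "P \<in> carrier_mat n n" "R \<in> carrier_mat n n" "D \<in> carrier_mat n n"
    "transpose_mat P \<in> carrier_mat n n" "transpose_mat R \<in> carrier_mat n n"
    by (simp_all add: P_def R_def D_def)
  have WT: "transpose_mat W = four_block_mat (transpose_mat P) (transpose_mat R) (transpose_mat R) (transpose_mat P)"
    unfolding W_def by (rule transpose_four_block_mat) (use c in auto)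
  have PR: "transpose_mat P * R = transpose_mat R * P"
    by (rule eq_matI) (auto simp: P_def R_def scalar_prod_def mult_ac)
  have PP: "transpose_mat P * P + - (transpose_mat R * R) = 1\<^sub>m n"
  proof (rule eq_matI)
    fix j k assume jk: "j < dim_row (1\<^sub>m n :: real mat)" "k < dim_col (1\<^sub>m n :: real mat)"
    have "(transpose_mat P * P + - (transpose_mat R * R)) $$ (j, k) =
        (\<Sum>i<n. ((c i)\<^sup>2 - (s i)\<^sup>2) * (U i j * U i k))"
      using jk by (simp add: P_def R_def scalar_prod_def atLeast0LessThan power2_eq_square
          sum_subtractf[symmetric] algebra_simps)
    also have "\<dots> = (\<Sum>i<n. U i j * U i k)" using cs by (intro sum.cong) auto
    finally show "(transpose_mat P * P + - (transpose_mat R * R)) $$ (j, k) = 1\<^sub>m n $$ (j, k)"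
      using orthonormal_rows_columns[OF U] jk by simp
  qed (auto simp: P_def R_def)
  have PP': "- (transpose_mat P * P) + transpose_mat R * R = - 1\<^sub>m n"
    unfolding PP[symmetric] using c by (intro eq_matI) auto
  have WTJ: "transpose_mat W * J_mat n =
      four_block_mat (- transpose_mat R) (transpose_mat P) (- transpose_mat P) (transpose_mat R)"
    unfolding WT J_mat_def using c
    by (subst mult_four_block_mat[of _ n n _ n _ n _ _ n _ n]) auto
  have z: "- (transpose_mat R * P) + transpose_mat R * P = 0\<^sub>m n n"
    using c by (intro eq_matI) auto
  have "transpose_mat W * J_mat n * W = J_mat n"
  proof -
    have "transpose_mat W * J_mat n * W = four_block_mat
       (- (transpose_mat R * P) + transpose_mat P * R) (- (transpose_mat R * R) + transpose_mat P * P)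
       (- (transpose_mat P * P) + transpose_mat R * R) (- (transpose_mat P * R) + transpose_mat R * P)"
      unfolding WTJ unfolding W_def using c
      by (subst mult_four_block_mat[of _ n n _ n _ n _ _ n _ n]) auto
    also have "- (transpose_mat R * R) + transpose_mat P * P = 1\<^sub>m n"
      unfolding PP[symmetric] by (rule comm_add_mat) (use c in auto)
    finally show ?thesis unfolding PR z PP' J_mat_def .
  qed
  then have "symplectic_mat n W"
    unfolding symplectic_mat_def using c by (auto simp: W_def mult_2)
  then have will: "williamson_diag n A d"
    unfolding williamson_diag_def A_def D_def using d by blast
  have "W * direct_sum_mat D D = four_block_mat (P * D) (R * D) (R * D) (P * D)"
    unfolding direct_sum_mat_def W_def using c
    by (subst mult_four_block_mat[of _ n n _ n _ n _ _ n _ n]) auto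
  then have A: "A = four_block_mat (P * D * transpose_mat P + R * D * transpose_mat R)
      (P * D * transpose_mat R + R * D * transpose_mat P)
      (R * D * transpose_mat P + P * D * transpose_mat R)
      (R * D * transpose_mat R + P * D * transpose_mat P)"
    unfolding A_def WT using c
    by (subst mult_four_block_mat[of _ n n _ n _ n _ _ n _ n, symmetric]) auto
  have entry: "(P * D * transpose_mat P) $$ (i, i) = (c i)\<^sup>2 * (\<Sum>j<n. (U i j)\<^sup>2 * d $ j)"
    "(R * D * transpose_mat R) $$ (i, i) = (s i)\<^sup>2 * (\<Sum>j<n. (U i j)\<^sup>2 * d $ j)" if "i < n" for i
    unfolding D_def mat_diag_mult_right[OF c(1)] mat_diag_mult_right[OF c(2)] using that
    by (auto simp: P_def R_def scalar_prod_def atLeast0LessThan power2_eq_square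
        sum_distrib_left mult_ac)
  have "A $$ (i, i) = ((c i)\<^sup>2 + (s i)\<^sup>2) * (\<Sum>j<n. (U i j)\<^sup>2 * d $ j) \<and>
      A $$ (n + i, n + i) = ((c i)\<^sup>2 + (s i)\<^sup>2) * (\<Sum>j<n. (U i j)\<^sup>2 * d $ j)" if "i < n" for i
    using that c entry[OF that] unfolding A by (auto simp: distrib_right)
  with will show ?thesis by blast
qed

section \<open>Squeezing factors and assembly of the matrix\<close>

lemma hyperbolic_pair:
  fixes r :: real
  assumes "1 \<le> r"
  obtains c s where "c\<^sup>2 - s\<^sup>2 = 1" "c\<^sup>2 + s\<^sup>2 = r"
proof
  \<comment> \<open>Adding and subtracting the two equations determines the squares of
    \<open>c\<close> and \<open>s\<close>; \<open>1 \<le> r\<close> keeps the second radicand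
    nonnegative.\<close>
  have "(sqrt ((r + 1) / 2))\<^sup>2 = (r + 1) / 2" "(sqrt ((r - 1) / 2))\<^sup>2 = (r - 1) / 2"
    using assms by (auto intro: real_sqrt_pow2)
  then show "(sqrt ((r + 1) / 2))\<^sup>2 - (sqrt ((r - 1) / 2))\<^sup>2 = 1"
    "(sqrt ((r + 1) / 2))\<^sup>2 + (sqrt ((r - 1) / 2))\<^sup>2 = r"
    by (auto simp: field_simps)
qed

text \<open>The squared entries of a unit row are weights summing to one. This makes each
  \<open>zs ! i\<close> positive, so that the ratio \<open>x $ i / zs ! i\<close> is a legitimate
  squeezing factor.\<close>

lemma orthonormal_row_average_pos:
  assumes "orthonormal_rows n U" "i < n" "\<forall>j<n. d j > 0"
  shows "(\<Sum>j<n. (U i j)\<^sup>2 * d j) > 0"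
proof -
  have "(\<Sum>j<n. U i j * U i j) = 1"
    using assms unfolding orthonormal_rows_def by auto
  then obtain k where "k < n" "U i k \<noteq> 0"
    by (metis (no_types, lifting) lessThan_iff mult_zero_left sum.neutral zero_neq_one)
  then show ?thesis
    by (intro sum_pos2[of _ k]) (use assms(3) in \<open>auto intro: less_imp_le\<close>)
qed

lemma weakly_supermajorized_prefix_sums:
  assumes "weakly_supermajorized n x y" "x \<in> carrier_vec n" "y \<in> carrier_vec n" "k \<le> n"
  shows "sum_list (take k (sort (list_of_vec y))) \<le> sum_list (take k (sort (list_of_vec x)))"
proof (cases "k = 0")
  case False
  then show ?thesis
    using assms unfolding weakly_supermajorized_def increasing_rearrangement_def
    by (auto simp: sum_list_sum_nth vec_of_list_index atLeast0LessThan)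
qed simp

theorem theorem4p2:
  fixes M :: "real \<Rightarrow> real \<Rightarrow> real" and n :: nat and x y :: "real vec"
  assumes "is_mean M"
    and "n \<ge> 1"
    and "x \<in> carrier_vec n" and "y \<in> carrier_vec n"
    and "\<forall>i<n. x $ i > 0" and "\<forall>i<n. y $ i > 0"
    and "weakly_supermajorized n x y"
  shows "\<exists>A. positive_definite (2 * n) A \<and>
             symplectic_diag M n A = x \<and>
             symplectic_eigenvalues n A = increasing_rearrangement y"
proof -
  define ys where "ys = sort (list_of_vec y)"
  \<comment> \<open>Using \<open>y\<close> in sorted order makes the Williamson diagonal of
    \<open>A\<close> already the vector that \<open>symplectic_eigenvalues\<close> selects.\<close>
  define d where "d = increasing_rearrangement y"
  have len: "length ys = n" using assms(4) by (simp add: ys_def)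
  have dys: "d $ j = ys ! j" for j
    unfolding d_def ys_def increasing_rearrangement_def by (simp add: vec_of_list_index)
  have d: "d \<in> carrier_vec n"
    using assms(4) unfolding d_def increasing_rearrangement_def carrier_vec_def by simp
  have "\<forall>u\<in>set (list_of_vec y). u > 0"
    using assms(4,6) by (auto simp: in_set_conv_nth list_of_vec_index)
  then have ypos: "\<forall>j<n. d $ j > 0"
    unfolding dys using len by (metis nth_mem set_sort ys_def)
  obtain zs where "conjugate_diagonal n (\<lambda>j. ys ! j) zs" and le: "list_all2 (\<le>) zs (list_of_vec x)"
    using conjugate_diagonal_below[of "list_of_vec x" n ys] assms(3,7) len
      weakly_supermajorized_prefix_sums[OF assms(7,3,4)]
    by (auto simp: ys_def)
  then obtain U where U: "orthonormal_rows n U"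
    and z: "\<And>i. i < n \<Longrightarrow> (\<Sum>j<n. (U i j)\<^sup>2 * d $ j) = zs ! i"
    unfolding conjugate_diagonal_def dys by blast
  have zpos: "zs ! i > 0" if "i < n" for i
    using orthonormal_row_average_pos[OF U that ypos] z[OF that] by simp
  have zle: "zs ! i \<le> x $ i" if "i < n" for i
    using le that assms(3) unfolding list_all2_conv_all_nth by (simp add: list_of_vec_index)
  \<comment> \<open>Squeezing can only enlarge the diagonal; it suffices because \<open>zs\<close>
    lies below \<open>x\<close> entrywise, so every ratio is at least 1.\<close>
  have "\<exists>c s. c\<^sup>2 - s\<^sup>2 = 1 \<and> c\<^sup>2 + s\<^sup>2 = x $ i / zs ! i" if "i < n" for i
    using hyperbolic_pair[of "x $ i / zs ! i"] zle[OF that] zpos[OF that] by (metis le_divide_eq_1_pos)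
  then obtain c s where cs: "\<And>i. i < n \<Longrightarrow> (c i)\<^sup>2 - (s i)\<^sup>2 = 1"
    "\<And>i. i < n \<Longrightarrow> (c i)\<^sup>2 + (s i)\<^sup>2 = x $ i / zs ! i"
    by metis
  obtain A where A: "williamson_diag n A d"
    and diag: "\<And>i. i < n \<Longrightarrow> A $$ (i, i) = x $ i" "\<And>i. i < n \<Longrightarrow> A $$ (n + i, n + i) = x $ i"
    using squeezed_orthogonal_williamson[of n U c s d, OF U cs(1) d ypos] cs(2) z zpos
    by fastforce
  \<comment> \<open>The bounds \<open>a \<le> M a b\<close> and \<open>M a b \<le> b\<close>
    coincide at \<open>b = a\<close>, and both diagonal entries of mode \<open>i\<close> equal
    \<open>x $ i\<close>.\<close>
  have "M a a = a" if "a > 0" for a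
    using assms(1) that unfolding is_mean_def by (meson order.antisym order.refl)
  then have "symplectic_diag M n A = x"
    unfolding symplectic_diag_def using assms(3,5) diag by (intro eq_vecI) auto
  moreover have "increasing_rearrangement d = d"
    unfolding d_def increasing_rearrangement_def by (simp add: list_vec sorted_sort_id)
  ultimately show ?thesis
    using williamson_diag_positive_definite[OF A] symplectic_eigenvalues_eqI[OF A] d_def by blast
qed

end
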